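(* The sequent calculus $\mathfrak{G}$ does not admit cut-elimination; that is, there is a sequent which is provable in $\mathfrak{G}$ but every derivation of which in $\mathfrak{G}$ uses the rule (Cut).
   Context: $Fm$ is the set of formulas built from a denumerable set of propositional variables with binary connectives $\wedge,\vee$, unary connectives $\neg,\square$ and the constant $\bot$. A sequent of $\mathfrak{G}$ is an expression $\Delta\Rightarrow\alpha$ where $\Delta\cup\{\alpha\}$ is a finite subset of $Fm$ ($\Delta$ is a finite, possibly empty, set; $\Delta,\beta$ means $\Delta\cup\{\beta\}$). The calculus $\mathfrak{G}$ has the following axioms and rules (premises / conclusion), for all formulas $\alpha,\beta,\gamma$ and finite sets $\Delta$: Axioms: $\alpha\Rightarrow\alpha$; and $\Rightarrow\alpha\vee\neg\square\alpha$. (Weakening) $\Delta\Rightarrow\alpha$ / $\Delta,\beta\Rightarrow\alpha$. (Cut) $\Delta\Rightarrow\alpha$ and $\Delta,\alpha\Rightarrow\beta$ / $\Delta\Rightarrow\beta$. ($\wedge\Rightarrow$) $\Delta,\alpha,\beta\Rightarrow\gamma$ / $\Delta,\alpha\wedge\beta\Rightarrow\gamma$. ($\Rightarrow\wedge$) $\Delta\Rightarrow\alpha$ and $\Delta\Rightarrow\beta$ / $\Delta\Rightarrow\alpha\wedge\beta$. ($\vee\Rightarrow$) $\Delta,\alpha\Rightarrow\gamma$ and $\Delta,\beta\Rightarrow\gamma$ / $\Delta,\alpha\vee\beta\Rightarrow\gamma$. ($\Rightarrow\vee$)$_1$ $\Delta\Rightarrow\alpha$ / $\Delta\Rightarrow\alpha\vee\beta$.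 ($\Rightarrow\vee$)$_2$ $\Delta\Rightarrow\beta$ / $\Delta\Rightarrow\alpha\vee\beta$. ($\neg$) $\alpha\Rightarrow\beta$ / $\neg\beta\Rightarrow\neg\alpha$. ($\bot$) $\Delta\Rightarrow\bot$ / $\Delta\Rightarrow\alpha$. ($\neg\neg\Rightarrow$) $\Delta,\alpha\Rightarrow\beta$ / $\Delta,\neg\neg\alpha\Rightarrow\beta$. ($\Rightarrow\neg\neg$) $\Delta\Rightarrow\alpha$ / $\Delta\Rightarrow\neg\neg\alpha$. ($\square\Rightarrow$) $\Delta,\alpha,\neg\alpha\Rightarrow\beta$ / $\Delta,\alpha,\neg\square\alpha\Rightarrow\beta$. ($\Rightarrow\square$) $\Delta\Rightarrow\alpha\wedge\neg\alpha$ / $\Delta\Rightarrow\alpha\wedge\neg\square\alpha$. A sequent is provable in $\mathfrak{G}$ if it has a derivation (finite tree built from axioms by the rules). *)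

theory Defs
  imports Main "HOL-Library.FSet"
begin

datatype fm =
    Var nat
  | Bot
  | Neg fm
  | Box fm
  | And fm fm
  | Or fm fm

datatype sequent = Seq "fm fset" fm  (infix "\<turnstile>" 50)

datatype rule =
    Ax_Id | Ax_Box
  | Weakening | Cut
  | AndL | AndR
  | OrL | OrR1 | OrR2
  | NegR | BotR
  | NegNegL | NegNegR
  | BoxL | BoxR

text \<open>
  \<open>inference r Ps S\<close>: the sequent \<open>S\<close> follows from the premises \<open>Ps\<close> by one application of
  the rule \<open>r\<close>; axioms are rules without premises.  Antecedents are sets, so in \<open>finsert \<alpha> \<Delta>\<close>
  the formula \<open>\<alpha>\<close> may already belong to \<open>\<Delta>\<close>; in particular a left rule can retain its
  principal formula in the premises.
\<close>

inductive inference :: "rule \<Rightarrow> sequent list \<Rightarrow> sequent \<Rightarrow> bool" where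
  ax_id: "inference Ax_Id [] ({|\<alpha>|} \<turnstile> \<alpha>)"
| ax_box: "inference Ax_Box [] ({||} \<turnstile> Or \<alpha> (Neg (Box \<alpha>)))"
| weakening: "inference Weakening [\<Delta> \<turnstile> \<alpha>] (finsert \<beta> \<Delta> \<turnstile> \<alpha>)"
| cut: "inference Cut [\<Delta> \<turnstile> \<alpha>, finsert \<alpha> \<Delta> \<turnstile> \<beta>] (\<Delta> \<turnstile> \<beta>)"
| andL: "inference AndL [finsert \<alpha> (finsert \<beta> \<Delta>) \<turnstile> \<gamma>] (finsert (And \<alpha> \<beta>) \<Delta> \<turnstile> \<gamma>)"
| andR: "inference AndR [\<Delta> \<turnstile> \<alpha>, \<Delta> \<turnstile> \<beta>] (\<Delta> \<turnstile> And \<alpha> \<beta>)"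
| orL: "inference OrL [finsert \<alpha> \<Delta> \<turnstile> \<gamma>, finsert \<beta> \<Delta> \<turnstile> \<gamma>] (finsert (Or \<alpha> \<beta>) \<Delta> \<turnstile> \<gamma>)"
| orR1: "inference OrR1 [\<Delta> \<turnstile> \<alpha>] (\<Delta> \<turnstile> Or \<alpha> \<beta>)"
| orR2: "inference OrR2 [\<Delta> \<turnstile> \<beta>] (\<Delta> \<turnstile> Or \<alpha> \<beta>)"
| negR: "inference NegR [{|\<alpha>|} \<turnstile> \<beta>] ({|Neg \<beta>|} \<turnstile> Neg \<alpha>)"
| botR: "inference BotR [\<Delta> \<turnstile> Bot] (\<Delta> \<turnstile> \<alpha>)"
| negnegL: "inference NegNegL [finsert \<alpha> \<Delta> \<turnstile> \<beta>] (finsert (Neg (Neg \<alpha>)) \<Delta> \<turnstile> \<beta>)"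
| negnegR: "inference NegNegR [\<Delta> \<turnstile> \<alpha>] (\<Delta> \<turnstile> Neg (Neg \<alpha>))"
| boxL: "inference BoxL [finsert \<alpha> (finsert (Neg \<alpha>) \<Delta>) \<turnstile> \<beta>]
           (finsert \<alpha> (finsert (Neg (Box \<alpha>)) \<Delta>) \<turnstile> \<beta>)"
| boxR: "inference BoxR [\<Delta> \<turnstile> And \<alpha> (Neg \<alpha>)] (\<Delta> \<turnstile> And \<alpha> (Neg (Box \<alpha>)))"

datatype tree = Node (rule_of: rule) (root: sequent) (subtrees: "tree list")

fun is_derivation :: "tree \<Rightarrow> bool" where
  "is_derivation (Node r S ts) \<longleftrightarrow>
     inference r (map root ts) S \<and> (\<forall>t \<in> set ts. is_derivation t)"

definition derives :: "tree \<Rightarrow> sequent \<Rightarrow> bool" where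
  "derives t S \<longleftrightarrow> is_derivation t \<and> root t = S"

definition provable :: "sequent \<Rightarrow> bool" where
  "provable S \<longleftrightarrow> (\<exists>t. derives t S)"

fun uses_rule :: "rule \<Rightarrow> tree \<Rightarrow> bool" where
  "uses_rule q (Node r S ts) \<longleftrightarrow> r = q \<or> (\<exists>t \<in> set ts. uses_rule q t)"

end

theory Submission
  imports Defs
begin

text \<open>
  The witness is \<open>\<Rightarrow> \<not>\<bottom>\<close>.

  It is provable because the calculus has a theorem \<open>\<tau> = \<alpha> \<or> \<not>\<box>\<alpha>\<close>, whence also \<open>\<Rightarrow> \<not>\<not>\<tau>\<close>, and
  because contraposing \<open>\<bottom> \<Rightarrow> \<not>\<tau>\<close> gives \<open>\<not>\<not>\<tau> \<Rightarrow> \<not>\<bottom>\<close>; a cut on \<open>\<not>\<not>\<tau>\<close> composes the two.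

  No cut-free derivation exists because contraposition, the rule that produces \<open>\<not>\<bottom>\<close> above, leaves
  a formula in the antecedent, and only a cut has an empty antecedent below a nonempty one.
  Reading upwards without cut from \<open>\<Rightarrow> \<not>\<bottom>\<close>, the only applicable rule is \<open>(\<bottom>)\<close>, whose premise
  \<open>\<Rightarrow> \<bottom>\<close> can again only come from \<open>(\<bottom>)\<close> with the same premise; so no finite tree reaches the
  axioms.
\<close>

lemma provable_inference:
  assumes "inference r Ps S" and "\<forall>P \<in> set Ps. provable P"
  shows "provable S"
proof -
  from assms(2) obtain f where f: "\<forall>P \<in> set Ps. derives (f P) P"
    unfolding provable_def by metis
  then have "map root (map f Ps) = Ps"
    by (simp add: derives_def map_idI)
  with assms(1) f have "derives (Node r S (map f Ps)) S"
    by (auto simp: derives_def)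
  then show ?thesis
    unfolding provable_def by blast
qed

lemma provable_Neg_Bot: "provable ({||} \<turnstile> Neg Bot)"
proof -
  let ?\<tau> = "Or Bot (Neg (Box Bot))"
  have "provable ({||} \<turnstile> ?\<tau>)"
    by (rule provable_inference[OF ax_box]) simp
  then have theorem_nn: "provable ({||} \<turnstile> Neg (Neg ?\<tau>))"
    by (intro provable_inference[OF negnegR]) simp
  have "provable ({|Bot|} \<turnstile> Bot)"
    by (rule provable_inference[OF ax_id]) simp
  then have "provable ({|Bot|} \<turnstile> Neg ?\<tau>)"
    by (intro provable_inference[OF botR]) simp
  then have "provable ({|Neg (Neg ?\<tau>)|} \<turnstile> Neg Bot)"
    by (intro provable_inference[OF negR]) simp
  with theorem_nn show ?thesis
    by (intro provable_inference[OF cut]) simp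
qed

text \<open>
  The two succedents are treated together because they form a set closed under going upwards:
  the last rule of a cut-free derivation of either sequent must be \<open>(\<bottom>)\<close>, with premise \<open>\<Rightarrow> \<bottom>\<close>.
\<close>

lemma Cut_if_derivation_of_Bot_or_Neg_Bot:
  assumes "is_derivation t" and "root t = ({||} \<turnstile> \<gamma>)" and "\<gamma> = Bot \<or> \<gamma> = Neg Bot"
  shows "uses_rule Cut t"
  using assms
proof (induction t arbitrary: \<gamma>)
  case (Node r S ts)
  have "inference r (map root ts) ({||} \<turnstile> \<gamma>)"
    using Node.prems by simp
  then have "r = Cut \<or> map root ts = [{||} \<turnstile> Bot]"
    using Node.prems(3) by cases auto
  then show ?case
  proof
    assume "map root ts = [{||} \<turnstile> Bot]"
    then obtain u where "ts = [u]" and "root u = ({||} \<turnstile> Bot)"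
      by auto
    then show ?thesis
      using Node by auto
  qed simp
qed

theorem theorem3p5:
  "\<exists>S :: sequent. provable S \<and> (\<forall>t. derives t S \<longrightarrow> uses_rule Cut t)"
  using provable_Neg_Bot Cut_if_derivation_of_Bot_or_Neg_Bot
  unfolding derives_def by blast

end
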